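(* Suppose that $f(z)=h(z)+\overline{g(z)}=\sum_{k=0}^{\infty}a_kz^k+\overline{\sum_{k=1}^{\infty}b_kz^k}$ is a transcendental harmonic entire mapping of order $\rho$, and $R_n$ is the radius of univalence of $f^{(n)}=h^{(n)}+\overline{g^{(n)}}$. Then $$\liminf_{n\to\infty}\frac{\log(\max\{1,nR_n\})}{\log n}\le\frac{1}{\rho}.$$
   Context: A harmonic entire mapping is a complex-valued harmonic function $f$ on $\mathbb{C}$, written $f=h+\overline{g}$ with $h,g$ entire and $g(0)=0$. It is a harmonic polynomial if both $h$ and $g$ are polynomials, and transcendental if it is not a harmonic polynomial. With $M(r,f)=\max_{|z|=r}|f(z)|$, the order of $f$ is $\rho=\limsup_{r\to\infty}\frac{\log\log M(r,f)}{\log r}\in[0,\infty]$. For each $n\ge 0$, the radius of univalence $R_n\in[0,\infty]$ is the largest number such that $f^{(n)}$ is univalent (injective) in $|z|<R_n$ (with $R_n=0$ if $f^{(n)}$ is not univalent in any disk centred at $0$). Conventions: $1/\rho=\infty$ if $\rho=0$ and $1/\rho=0$ if $\rho=\infty$. *)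

theory Defs
  imports "HOL-Analysis.Analysis"
begin

text \<open>
  A harmonic entire mapping is handled together with its canonical representation
  \<open>f = h + cnj g\<close>; the normalisation \<open>g 0 = 0\<close> makes \<open>h\<close> and \<open>g\<close> unique.
\<close>

definition harmonic_entire_mapping ::
  "(complex \<Rightarrow> complex) \<Rightarrow> (complex \<Rightarrow> complex) \<Rightarrow> (complex \<Rightarrow> complex) \<Rightarrow> bool" where
  "harmonic_entire_mapping f h g \<longleftrightarrow>
     h holomorphic_on UNIV \<and> g holomorphic_on UNIV \<and> g 0 = 0 \<and>
     (\<forall>z. f z = h z + cnj (g z))"

definition is_polynomial :: "(complex \<Rightarrow> complex) \<Rightarrow> bool" where
  "is_polynomial F \<longleftrightarrow> (\<exists>p :: complex poly. \<forall>z. F z = poly p z)"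

definition transcendental_harmonic_entire_mapping ::
  "(complex \<Rightarrow> complex) \<Rightarrow> (complex \<Rightarrow> complex) \<Rightarrow> (complex \<Rightarrow> complex) \<Rightarrow> bool" where
  "transcendental_harmonic_entire_mapping f h g \<longleftrightarrow>
     harmonic_entire_mapping f h g \<and> \<not> (is_polynomial h \<and> is_polynomial g)"

definition harmonic_nth_deriv ::
  "(complex \<Rightarrow> complex) \<Rightarrow> (complex \<Rightarrow> complex) \<Rightarrow> nat \<Rightarrow> complex \<Rightarrow> complex" where
  "harmonic_nth_deriv h g n z = (deriv ^^ n) h z + cnj ((deriv ^^ n) g z)"

text \<open>For continuous \<open>f\<close> and \<open>r \<ge> 0\<close> the supremum is attained, the circle being compact.\<close>

definition max_modulus :: "(complex \<Rightarrow> complex) \<Rightarrow> real \<Rightarrow> real" where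
  "max_modulus f r = (SUP z\<in>sphere 0 r. cmod (f z))"

text \<open>
  Only large \<open>r\<close> matter; the total real logarithm has its usual meaning at both levels
  as soon as \<open>max_modulus f r > 1\<close>.
\<close>

definition growth_order :: "(complex \<Rightarrow> complex) \<Rightarrow> ereal" where
  "growth_order f = Limsup at_top (\<lambda>r::real. ereal (ln (ln (max_modulus f r)) / ln r))"

text \<open>
  \<open>eball 0 \<infinity>\<close> is the whole plane, so the value is \<open>\<infinity>\<close> for a map injective on the plane;
  \<open>eball 0 0\<close> is empty, so the value is \<open>0\<close> for a map injective on no disk about \<open>0\<close>.
\<close>

definition radius_of_univalence :: "(complex \<Rightarrow> complex) \<Rightarrow> ereal" where
  "radius_of_univalence F = Sup {R. 0 \<le> R \<and> inj_on F (eball 0 R)}"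

definition ln_ereal :: "ereal \<Rightarrow> ereal" where
  "ln_ereal x =
     (if x \<le> 0 then -\<infinity> else if x = \<infinity> then \<infinity> else ereal (ln (real_of_ereal x)))"

end

theory Submission
  imports Defs "HOL-Complex_Analysis.Complex_Analysis" "HOL-Real_Asymp.Real_Asymp"
begin

text \<open>
  An injective harmonic map \<open>F = H + cnj G\<close> on a disk of radius \<open>R\<close> satisfies
  \<open>R (|H''(0)| + |G''(0)|) \<le> C (|H'(0)| + |G'(0)|)\<close>. Applied to \<open>f\<^sup>(\<^sup>n\<^sup>)\<close> this bounds the ratio of consecutive
  Taylor coefficients by \<open>C / (n R\<^sub>n)\<close>; if \<open>n R\<^sub>n > n\<^sup>s\<close> for all large \<open>n\<close>, the coefficients are
  \<open>O(B\<^sup>n / n!\<^sup>s)\<close>, so the order is at most \<open>1 / s\<close>, which is impossible for \<open>s > 1 / \<rho>\<close>.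

  For the coefficient bound, Lewy's theorem lets us assume \<open>|G'| < |H'|\<close>. If \<open>R |H''(0) / H'(0)|\<close>
  is huge, rescaling at a maximum point of \<open>(r - |z|) |H'' / H'|\<close> gives an injective map on a huge
  disk with \<open>|H'' / H'| \<le> 2\<close> and \<open>H' = H'' = 1\<close> at the centre. There \<open>H'' / H'\<close> and \<open>G' / H'\<close>
  are nearly constant by Schwarz and Schwarz-Pick, so up to an invertible real-linear map \<open>F\<close> is
  close to \<open>exp z - 1\<close>, which takes the value \<open>0\<close> both at \<open>0\<close> and at \<open>2 \<pi> \<i>\<close>.
\<close>

section \<open>Lewy's theorem\<close>

text \<open>Along the second ray \<open>v\<close> runs continuously from \<open>v 0\<close> to a
  value at least \<open>v (of_real c * u)\<close>, so the intermediate value theorem finds that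
  value on the way. The two points differ because equal moduli would give \<open>t = c\<close> and
  then \<open>u = u'\<close>.\<close>

lemma two_ray_collision:
  fixes v :: "complex \<Rightarrow> real"
  assumes cont: "continuous_on (ball 0 e) v" and "0 < c" "c < e"
    and u: "cmod u = 1" "cmod u' = 1" "u \<noteq> u'"
    and side: "v 0 \<le> v (of_real c * u)" "v (of_real c * u) \<le> v (of_real c * u')"
  shows "\<exists>s t. 0 \<le> s \<and> s < e \<and> 0 \<le> t \<and> t < e \<and> of_real s * u \<noteq> of_real t * u' \<and>
           v (of_real s * u) = v (of_real t * u')"
proof -
  have "continuous_on {0..c} (\<lambda>t. v (of_real t * u'))"
    by (rule continuous_on_compose2 [OF cont])
       (use assms in \<open>auto intro!: continuous_intros simp: norm_mult\<close>)
  then obtain t where t: "0 \<le> t" "t \<le> c" "v (of_real t * u') = v (of_real c * u)"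
    using IVT'[of "\<lambda>t. v (of_real t * u')" 0 "v (of_real c * u)" c] side \<open>0 < c\<close> by auto
  moreover have "of_real c * u \<noteq> of_real t * u'"
  proof
    assume eq: "of_real c * u = of_real t * u'"
    then have "cmod (of_real c * u) = cmod (of_real t * u')"
      by simp
    then have "c = t"
      using u t \<open>0 < c\<close> by (simp add: norm_mult)
    with eq u \<open>0 < c\<close> show False
      by simp
  qed
  ultimately show ?thesis
    using \<open>0 < c\<close> \<open>c < e\<close> by (intro exI[of _ c] exI[of _ t]) auto
qed

text \<open>Three legs leave the origin but a line has only two sides: two of the three end values
  lie weakly on the same side of \<open>v 0\<close>. The one nearer to \<open>v 0\<close> is
  attained again on the other leg.\<close>

lemma tripod_not_embedded_in_line:
  fixes v :: "complex \<Rightarrow> real"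
  assumes cont: "continuous_on (ball 0 e) v" and "0 < e"
    and norm: "\<And>u. u \<in> U \<Longrightarrow> cmod u = 1"
    and U: "u1 \<in> U" "u2 \<in> U" "u3 \<in> U" "u1 \<noteq> u2" "u1 \<noteq> u3" "u2 \<noteq> u3"
  shows "\<exists>u\<in>U. \<exists>u'\<in>U. \<exists>s t. 0 \<le> s \<and> s < e \<and> 0 \<le> t \<and> t < e \<and>
           of_real s * u \<noteq> of_real t * u' \<and> v (of_real s * u) = v (of_real t * u')"
proof -
  define c where "c = e / 2"
  have c: "0 < c" "c < e"
    using \<open>0 < e\<close> by (auto simp: c_def)
  let ?x = "\<lambda>u. v (of_real c * u)"
  have pair: ?thesis
    if "u \<in> U" "u' \<in> U" "u \<noteq> u'"
      "v 0 \<le> ?x u \<and> ?x u \<le> ?x u' \<or> ?x u' \<le> ?x u \<and> ?x u \<le> v 0" for u u'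
  proof (cases "v 0 \<le> ?x u \<and> ?x u \<le> ?x u'")
    case True
    then show ?thesis
      using two_ray_collision[OF cont c norm norm] that by blast
  next
    case False
    \<comment> \<open>Legs on which \<open>v\<close> goes down are handled by reflecting the
      line.\<close>
    have "continuous_on (ball 0 e) (\<lambda>z. - v z)"
      by (intro continuous_intros cont)
    moreover have "- v 0 \<le> - ?x u" "- ?x u \<le> - ?x u'"
      using False that by auto
    ultimately have "\<exists>s t. 0 \<le> s \<and> s < e \<and> 0 \<le> t \<and> t < e \<and> of_real s * u \<noteq> of_real t * u' \<and>
        - v (of_real s * u) = - v (of_real t * u')"
      using two_ray_collision[of e "\<lambda>z. - v z" c u u'] c norm that by blast
    then show ?thesis
      using that by (metis neg_equal_iff_equal)
  qed
  have both: ?thesis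
    if "u \<in> U" "u' \<in> U" "u \<noteq> u'"
      "v 0 \<le> ?x u \<and> v 0 \<le> ?x u' \<or> ?x u \<le> v 0 \<and> ?x u' \<le> v 0" for u u'
    using pair[OF that(1-3)] pair[OF that(2,1) that(3)[symmetric]] that(4)
      linear[of "?x u" "?x u'"] by argo
  consider "v 0 \<le> ?x u1" "v 0 \<le> ?x u2" | "?x u1 \<le> v 0" "?x u2 \<le> v 0"
    | "v 0 \<le> ?x u1" "v 0 \<le> ?x u3" | "?x u1 \<le> v 0" "?x u3 \<le> v 0"
    | "v 0 \<le> ?x u2" "v 0 \<le> ?x u3" | "?x u2 \<le> v 0" "?x u3 \<le> v 0"
    by linarith
  then show ?thesis
    using both U by cases blast+
qed

section \<open>Level sets at a critical point and nonvanishing of the Jacobian\<close>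

text \<open>A square root of \<open>- B / A\<close> works, and equal moduli make it unimodular. For
  \<open>A\<close>, \<open>B\<close> the derivatives of \<open>H\<close>, \<open>G\<close> at a zero
  of the Jacobian, \<open>e\<close> singles out the real component \<open>Re (e * F)\<close> of
  \<open>F = H + cnj G\<close> whose differential vanishes.\<close>

lemma unimodular_rotation_cancel:
  fixes A B :: complex
  assumes "cmod A = cmod B"
  obtains e where "cmod e = 1" "e * A + cnj e * B = 0"
proof (cases "A = 0")
  case True
  then show thesis
    using that[of 1] assms by simp
next
  case False
  define e where "e = csqrt (- B / A)"
  have e2: "e\<^sup>2 = - B / A"
    by (simp add: e_def)
  then have "(cmod e)\<^sup>2 = 1"
    using assms False by (auto simp: norm_divide simp flip: norm_power)
  then have e1: "cmod e = 1"
    by (simp add: power2_eq_1_iff) (use norm_ge_zero[of e] in linarith)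
  then have "e * cnj e = 1"
    by (simp add: complex_norm_square[symmetric])
  have "e * (e * A + cnj e * B) = e\<^sup>2 * A + (e * cnj e) * B"
    by (simp add: algebra_simps power2_eq_square)
  also have "\<dots> = 0"
    using e2 \<open>e * cnj e = 1\<close> False by simp
  finally show thesis
    using that e1 by (metis mult_eq_0_iff norm_zero zero_neq_one)
qed

text \<open>Near a critical point \<open>\<phi> - \<phi> z0\<close> is either zero or the
  \<open>n\<close>-th power of a local coordinate with \<open>n \<ge> 2\<close>. In that coordinate
  the level set of the real part is a union of at least four rays; \<open>q\<close> is the inverse
  of the coordinate, and three rays are kept.\<close>

lemma critical_point_level_tripod:
  assumes hol: "\<phi> holomorphic_on S" and S: "open S" "z0 \<in> S" and crit: "deriv \<phi> z0 = 0"
  obtains q e u1 u2 u3 where "0 < e" "continuous_on (ball 0 e) q" "inj_on q (ball 0 e)"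
    "q ` ball 0 e \<subseteq> S" "u1 \<noteq> u2" "u1 \<noteq> u3" "u2 \<noteq> u3"
    "\<forall>u\<in>{u1, u2, u3}. cmod u = 1"
    "\<forall>u\<in>{u1, u2, u3}. \<forall>t\<in>{0..<e}. Re (\<phi> (q (of_real t * u))) = Re (\<phi> z0)"
proof -
  obtain r where r: "r > 0" "ball z0 r \<subseteq> S"
    using S openE by blast
  have holr: "\<phi> holomorphic_on ball z0 r"
    using hol r holomorphic_on_subset by blast
  show thesis
  proof (cases "\<forall>n>0. (deriv ^^ n) \<phi> z0 = 0")
    \<comment> \<open>Here \<open>\<phi>\<close> is constant near \<open>z0\<close>, so a
      translation and any three directions serve.\<close>
    case True
    have flat: "\<phi> w = \<phi> z0" if "w \<in> ball z0 r" for w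
      using holomorphic_fun_eq_const_on_connected[OF holr, of z0 w] True that r by auto
    have const: "\<phi> (z0 + of_real t * u) = \<phi> z0" if "cmod u = 1" "0 \<le> t" "t < r" for t u
    proof (rule flat)
      show "z0 + of_real t * u \<in> ball z0 r"
        unfolding mem_ball dist_norm using that by (simp add: norm_mult)
    qed
    show thesis
    proof (rule that[of r "\<lambda>w. z0 + w" 1 "-1" \<i>])
      show "(+) z0 ` ball 0 r \<subseteq> S"
        using r(2) by (auto simp: dist_norm subset_iff)
      show "\<forall>u\<in>{1, - 1, \<i>}. \<forall>t\<in>{0..<r}. Re (\<phi> (z0 + complex_of_real t * u)) = Re (\<phi> z0)"
        using const by (metis atLeastLessThan_iff empty_iff insert_iff norm_ii norm_minus_cancel norm_one)
    qed (use r(1) in \<open>auto intro!: continuous_intros simp: complex_eq_iff\<close>)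
  next
    case False
    define n where "n = (LEAST n. 0 < n \<and> (deriv ^^ n) \<phi> z0 \<noteq> 0)"
    have n: "0 < n" "(deriv ^^ n) \<phi> z0 \<noteq> 0"
      using LeastI_ex[of "\<lambda>n. 0 < n \<and> (deriv ^^ n) \<phi> z0 \<noteq> 0"] False by (auto simp: n_def)
    have n_min: "(deriv ^^ i) \<phi> z0 = 0" if "0 < i" "i < n" for i
      using not_less_Least[of i "\<lambda>n. 0 < n \<and> (deriv ^^ n) \<phi> z0 \<noteq> 0"] that by (auto simp: n_def)
    have "n \<noteq> 1"
      using n crit by auto
    with n have n2: "n \<ge> 2"
      by auto
    obtain g r1 where r1: "0 < r1" and holg: "g holomorphic_on ball z0 r1"
      and fac: "\<And>w. w \<in> ball z0 r1 \<Longrightarrow> \<phi> w - \<phi> z0 = ((w - z0) * g w) ^ n"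
      and gnz: "\<And>w. w \<in> ball z0 r1 \<Longrightarrow> g w \<noteq> 0"
      using holomorphic_factor_order_of_zero_strong[OF holr _ _ n] n_min r by (metis centre_in_ball open_ball)
    define r2 where "r2 = min r r1"
    have r2: "0 < r2" "ball z0 r2 \<subseteq> ball z0 r" "ball z0 r2 \<subseteq> ball z0 r1"
      using r r1 by (auto simp: r2_def)
    define \<psi> where "\<psi> w = (w - z0) * g w" for w
    have hol\<psi>: "\<psi> holomorphic_on ball z0 r2"
      unfolding \<psi>_def by (intro holomorphic_intros holomorphic_on_subset[OF holg] r2)
    have "(g has_field_derivative deriv g z0) (at z0)"
      using holg r1 holomorphic_derivI by (metis centre_in_ball open_ball)
    then have "(\<psi> has_field_derivative g z0) (at z0)"
      unfolding \<psi>_def by (auto intro!: derivative_eq_intros)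
    then have "deriv \<psi> z0 \<noteq> 0"
      using gnz r1 DERIV_imp_deriv by (metis centre_in_ball)
    then obtain r3 where r3: "r3 > 0" "ball z0 r3 \<subseteq> ball z0 r2"
        "open (\<psi> ` ball z0 r3)" "inj_on \<psi> (ball z0 r3)"
      using has_complex_derivative_locally_invertible[OF hol\<psi>] r2 by (metis centre_in_ball open_ball)
    obtain q where holq: "q holomorphic_on \<psi> ` ball z0 r3"
      and inv: "\<And>z. z \<in> ball z0 r3 \<Longrightarrow> q (\<psi> z) = z"
      using holomorphic_has_inverse[OF holomorphic_on_subset[OF hol\<psi> r3(2)] open_ball r3(4)] by metis
    have "0 \<in> \<psi> ` ball z0 r3"
      using r3(1) by (auto simp: \<psi>_def intro!: image_eqI[of _ _ z0])
    then obtain e where e: "0 < e" "ball 0 e \<subseteq> \<psi> ` ball z0 r3"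
      using r3(3) openE by blast
    have q: "q w \<in> ball z0 r3" "\<psi> (q w) = w" if "w \<in> ball 0 e" for w
      using inv e(2) that by auto
    \<comment> \<open>The \<open>n\<close>-th powers of \<open>u\<close>, \<open>cnj u\<close> and
      \<open>- u\<close> are all \<open>\<i>\<close> or \<open>- \<i>\<close>. Since
      \<open>n \<ge> 2\<close>, \<open>u\<close> lies in the open first quadrant, which makes the
      three directions distinct.\<close>
    define u where "u = cis (pi / (2 * real n))"
    have ang: "0 < pi / (2 * real n)" "pi / (2 * real n) < pi / 2"
      using n2 by (auto simp: field_simps)
    then have "Im u > 0" "Re u > 0"
      by (auto simp: u_def intro!: sin_gt_zero cos_gt_zero)
    have u1: "cmod u = 1"
      by (simp add: u_def)
    have un: "u ^ n = \<i>"
      using n2 by (simp add: u_def Complex.DeMoivre)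
    have "Re (w ^ n) = 0" if "w \<in> {u, cnj u, - u}" for w
    proof -
      have "cnj u ^ n = - \<i>"
        using un by (metis complex_cnj_i complex_cnj_power)
      moreover have "(- u) ^ n = \<i> \<or> (- u) ^ n = - \<i>"
        using un by (cases "even n") auto
      ultimately show ?thesis
        using that un by auto
    qed
    then have re0: "Re ((of_real t * w) ^ n) = 0" if "w \<in> {u, cnj u, - u}" for t w
      using that by (simp add: power_mult_distrib flip: of_real_power)
    show thesis
    proof (rule that[of e q u "cnj u" "- u"])
      show "continuous_on (ball 0 e) q"
        using holq e holomorphic_on_imp_continuous_on continuous_on_subset by blast
      show "inj_on q (ball 0 e)"
        using q by (metis inj_onI)
      show "q ` ball 0 e \<subseteq> S"
        using q r3 r2 r by blast
      show "\<forall>w\<in>{u, cnj u, - u}. \<forall>t\<in>{0..<e}. Re (\<phi> (q (of_real t * w))) = Re (\<phi> z0)"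
      proof (intro ballI)
        fix w t
        assume w: "w \<in> {u, cnj u, - u}" and t: "t \<in> {0..<e}"
        have tw: "of_real t * w \<in> ball 0 e"
          using w t u1 by (auto simp: norm_mult)
        have "\<phi> (q (of_real t * w)) - \<phi> z0 = \<psi> (q (of_real t * w)) ^ n"
          using fac q(1)[OF tw] r3 r2 unfolding \<psi>_def by blast
        then have "\<phi> (q (of_real t * w)) = \<phi> z0 + (of_real t * w) ^ n"
          using q(2)[OF tw] by (simp add: algebra_simps)
        then show "Re (\<phi> (q (of_real t * w))) = Re (\<phi> z0)"
          using re0[OF w] by simp
      qed
      show "u \<noteq> cnj u" "u \<noteq> - u" "cnj u \<noteq> - u"
        using \<open>Im u > 0\<close> \<open>Re u > 0\<close> by (simp_all add: complex_eq_iff)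
      show "\<forall>w\<in>{u, cnj u, - u}. cmod w = 1"
        using u1 by simp
    qed (rule e)
  qed
qed

text \<open>
  At a zero of the Jacobian some real-linear component of the map is critical, and its level set
  contains three arcs that the map sends injectively into a line.
\<close>

lemma injective_harmonic_jacobian_nonzero:
  assumes H: "H holomorphic_on S" and G: "G holomorphic_on S" and S: "open S" "z0 \<in> S"
    and inj: "inj_on (\<lambda>z. H z + cnj (G z)) S"
  shows "cmod (deriv H z0) \<noteq> cmod (deriv G z0)"
proof
  assume "cmod (deriv H z0) = cmod (deriv G z0)"
  then obtain e where e: "cmod e = 1" "e * deriv H z0 + cnj e * deriv G z0 = 0"
    by (rule unimodular_rotation_cancel)
  \<comment> \<open>Conjugating the term \<open>e * cnj (G z)\<close> leaves its real part
    unchanged, so \<open>\<phi>\<close> is holomorphic and has the same real part as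
    \<open>e * F\<close>.\<close>
  define \<phi> where "\<phi> z = e * H z + cnj e * G z" for z
  define F where "F z = H z + cnj (G z)" for z
  have hol: "\<phi> holomorphic_on S"
    unfolding \<phi>_def by (intro holomorphic_intros H G)
  have "(\<phi> has_field_derivative 0) (at z0)"
    unfolding \<phi>_def
    by (rule derivative_eq_intros holomorphic_derivI[OF H S] holomorphic_derivI[OF G S] refl)+ (use e in \<open>simp add: mult.commute\<close>)
  then have crit: "deriv \<phi> z0 = 0"
    by (rule DERIV_imp_deriv)
  obtain q r u1 u2 u3 where q: "0 < r" "continuous_on (ball 0 r) q" "inj_on q (ball 0 r)"
    "q ` ball 0 r \<subseteq> S" and u: "u1 \<noteq> u2" "u1 \<noteq> u3" "u2 \<noteq> u3"
    and norm1: "\<forall>u\<in>{u1, u2, u3}. cmod u = 1"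
    and lev: "\<forall>u\<in>{u1, u2, u3}. \<forall>t\<in>{0..<r}. Re (\<phi> (q (of_real t * u))) = Re (\<phi> z0)"
    by (rule critical_point_level_tripod[OF hol S crit])
  have "continuous_on S F"
    unfolding F_def by (intro continuous_intros holomorphic_on_imp_continuous_on H G)
  then have "continuous_on (ball 0 r) (\<lambda>w. F (q w))"
    by (rule continuous_on_compose2) (use q in auto)
  then have "continuous_on (ball 0 r) (\<lambda>w. Im (e * F (q w)))"
    by (intro continuous_intros)
  then have "\<exists>w\<in>{u1, u2, u3}. \<exists>w'\<in>{u1, u2, u3}. \<exists>s t. 0 \<le> s \<and> s < r \<and> 0 \<le> t \<and> t < r \<and>
      of_real s * w \<noteq> of_real t * w' \<and>
      Im (e * F (q (of_real s * w))) = Im (e * F (q (of_real t * w')))"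
    by (rule tripod_not_embedded_in_line[OF _ q(1), where ?u1.0 = u1 and ?u2.0 = u2 and ?u3.0 = u3])
       (use u norm1 in auto)
  then obtain w w' s t where w: "w \<in> {u1, u2, u3}" "w' \<in> {u1, u2, u3}" "0 \<le> s" "s < r" "0 \<le> t" "t < r"
    "of_real s * w \<noteq> of_real t * w'" "Im (e * F (q (of_real s * w))) = Im (e * F (q (of_real t * w')))"
    by blast
  \<comment> \<open>On the arcs \<open>e * F\<close> has constant real part, so the coincidence of
    imaginary parts found above is a coincidence of values of \<open>F\<close>.\<close>
  have "Re (e * F z) = Re (\<phi> z)" for z
    by (simp add: F_def \<phi>_def algebra_simps)
  then have "e * F (q (of_real s * w)) = e * F (q (of_real t * w'))"
    using w(8) lev[rule_format, OF w(1), of s] lev[rule_format, OF w(2), of t] w(3-6)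
    by (simp add: complex_eq_iff)
  then have eq: "F (q (of_real s * w)) = F (q (of_real t * w'))"
    using e by auto
  have in_ball: "of_real s * w \<in> ball 0 r" "of_real t * w' \<in> ball 0 r"
    using w(3-6) bspec[OF norm1 w(1)] bspec[OF norm1 w(2)] by (simp_all add: norm_mult)
  then have "q (of_real s * w) = q (of_real t * w')"
    using eq inj q(4) unfolding F_def inj_on_def by blast
  then show False
    using q(3) in_ball w(7) by (meson inj_onD)
qed

section \<open>The second coefficient of an injective harmonic map\<close>

lemma Schwarz_Lemma_scaled:
  assumes hol: "f holomorphic_on ball 0 L" and L: "0 < L" and f0: "f 0 = 0"
    and bound: "\<And>z. z \<in> ball 0 L \<Longrightarrow> cmod (f z) < B" and z: "z \<in> ball 0 L"
  shows "cmod (f z) \<le> B * cmod z / L"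
proof -
  have B: "0 < B"
    using bound[of 0] L f0 by simp
  define g where "g w = f (of_real L * w) / of_real B" for w
  have sub: "of_real L * w \<in> ball 0 L" if "cmod w < 1" for w :: complex
    using that L by (simp add: norm_mult)
  have "(\<lambda>w. f (of_real L * w)) holomorphic_on ball 0 1"
    by (rule holomorphic_on_compose_gen[OF _ hol, unfolded o_def])
       (use sub in \<open>auto intro!: holomorphic_intros\<close>)
  then have "g holomorphic_on ball 0 1"
    unfolding g_def using B by (intro holomorphic_intros) auto
  moreover have "cmod (g w) < 1" if "cmod w < 1" for w
    using bound[OF sub[OF that]] B by (simp add: g_def norm_divide)
  moreover have "cmod (z / of_real L) < 1"
    using z L by (simp add: norm_divide)
  moreover have "g 0 = 0"
    using f0 by (simp add: g_def)
  ultimately have "cmod (g (z / of_real L)) \<le> cmod (z / of_real L)"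
    by (intro Schwarz_Lemma(1))
  then show ?thesis
    using L B by (simp add: g_def norm_divide field_simps)
qed

text \<open>Schwarz's lemma is applied after a Moebius map sending \<open>\<omega> 0\<close> to
  \<open>0\<close>. The factor \<open>1 - (cmod (\<omega> 0))\<^sup>2\<close> is the point of the
  estimate: it later cancels a division by the same quantity, which may be arbitrarily
  small.\<close>

lemma Schwarz_Pick_increment:
  assumes hol: "\<omega> holomorphic_on ball 0 L" and L: "0 < L"
    and bound: "\<And>z. z \<in> ball 0 L \<Longrightarrow> cmod (\<omega> z) < 1" and z: "2 * cmod z \<le> L"
  shows "cmod (\<omega> z - \<omega> 0) \<le> 2 * (1 - (cmod (\<omega> 0))\<^sup>2) * cmod z / L"
proof -
  define a where "a = \<omega> 0"
  define b where "b = \<omega> z"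
  have zL: "z \<in> ball 0 L"
  proof -
    have "cmod z < L"
      using z L norm_ge_zero[of z] by linarith
    then show ?thesis
      by simp
  qed
  have a1: "cmod a < 1" and b1: "cmod b < 1"
    using bound L zL by (auto simp: a_def b_def)
  define x where "x = cmod z / L"
  have x: "0 \<le> x" "x \<le> 1 / 2"
    using z L by (auto simp: x_def field_simps)
  have "(\<lambda>w. Moebius_function 0 a (\<omega> w)) holomorphic_on ball 0 L"
    by (rule holomorphic_on_compose_gen[OF hol Moebius_function_holomorphic[OF a1], unfolded o_def])
       (use bound in auto)
  then have "cmod (Moebius_function 0 a b) \<le> 1 * cmod z / L"
    unfolding b_def
    by (rule Schwarz_Lemma_scaled) (use L zL bound Moebius_function_norm_lt_1[OF a1] in
        \<open>auto simp: Moebius_function_eq_zero simp flip: a_def\<close>)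
  then have M: "cmod ((b - a) / (1 - cnj a * b)) \<le> x"
    by (simp add: Moebius_function_simple x_def)
  \<comment> \<open>This form bounds the Moebius denominator by \<open>1 - (cmod a)\<^sup>2\<close>
    plus \<open>cmod (b - a)\<close>; as \<open>x \<le> 1 / 2\<close>, the second contribution is
    absorbed into the left-hand side.\<close>
  have split: "1 - cnj a * b = of_real (1 - (cmod a)\<^sup>2) + cnj a * (a - b)"
    by (simp add: algebra_simps complex_norm_square del: of_real_power)
  have "cmod (cnj a * b) < 1"
    using norm_mult_less[of "cnj a" 1 b 1] a1 b1 by simp
  then have nz: "1 - cnj a * b \<noteq> 0"
    by auto
  have sq: "(cmod a)\<^sup>2 \<le> 1"
    using a1 by (simp add: power_le_one)
  have "cmod (b - a) \<le> x * cmod (1 - cnj a * b)"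
    using M nz by (simp add: norm_divide divide_le_eq)
  also have "\<dots> \<le> x * ((1 - (cmod a)\<^sup>2) + cmod (b - a))"
  proof (rule mult_left_mono)
    have "cmod (1 - cnj a * b) \<le> cmod (of_real (1 - (cmod a)\<^sup>2)) + cmod (cnj a * (a - b))"
      unfolding split by (rule norm_triangle_ineq)
    also have "cmod (of_real (1 - (cmod a)\<^sup>2)) = 1 - (cmod a)\<^sup>2"
      using sq by (subst norm_of_real) simp
    also have "cmod (cnj a * (a - b)) \<le> 1 * cmod (b - a)"
      unfolding norm_mult complex_mod_cnj norm_minus_commute[of a b]
      by (rule mult_right_mono) (use a1 in auto)
    finally show "cmod (1 - cnj a * b) \<le> 1 - (cmod a)\<^sup>2 + cmod (b - a)"
      by simp
  qed (rule x)
  also have "\<dots> \<le> x * (1 - (cmod a)\<^sup>2) + cmod (b - a) / 2"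
    using mult_right_mono[OF x(2), of "cmod (b - a)"] by (simp add: algebra_simps)
  finally show ?thesis
    by (simp add: x_def a_def b_def field_simps)
qed

section \<open>Harmonic maps close to the exponential\<close>

text \<open>A zero is a fixed point of \<open>z \<mapsto> 2 \<pi> \<i> + Ln (1 - E z)\<close>, which
  exists by Brouwer. A topological argument is used because the later \<open>E\<close> contains
  conjugates and is only continuous. The bound on \<open>E\<close> keeps \<open>1 - E z\<close> off
  the branch cut and its logarithm below \<open>1\<close> in modulus.\<close>

lemma exp_perturbation_zero:
  assumes cont: "continuous_on (cball (2 * of_real pi * \<i>) 1) E"
    and small: "\<And>z. z \<in> cball (2 * of_real pi * \<i>) 1 \<Longrightarrow> cmod (E z) \<le> 1 / 4"
  obtains z where "z \<in> cball (2 * of_real pi * \<i>) 1" "exp z - 1 + E z = 0"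
proof -
  let ?c = "2 * of_real pi * \<i>"
  define f where "f z = ?c + Ln (1 + (- E z))" for z
  have pos: "Re (1 + (- E z)) > 0" if "z \<in> cball ?c 1" for z
    using complex_Re_le_cmod[of "E z"] small[OF that] by simp
  have "continuous_on (cball ?c 1) f"
    unfolding f_def
  proof (intro continuous_intros cont)
    fix z assume "z \<in> cball ?c 1"
    from pos[OF this] show "1 + (- E z) \<notin> \<real>\<^sub>\<le>\<^sub>0"
      by (auto simp: complex_nonpos_Reals_iff)
  qed
  moreover have "f z \<in> cball ?c 1" if "z \<in> cball ?c 1" for z
    using norm_Ln_le[of "- E z"] small[OF that] by (simp add: f_def dist_norm)
  ultimately obtain z where z: "z \<in> cball ?c 1" "f z = z"
    using brouwer_ball[of 1 ?c f] by auto
  have "exp z = exp (f z)"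
    by (simp add: z)
  also have "\<dots> = exp (2 * of_real pi * \<i>) * exp (Ln (1 + (- E z)))"
    unfolding f_def by (rule exp_add)
  also have "\<dots> = 1 + (- E z)"
    using pos[OF z(1)] by (subst exp_Ln) auto
  finally show thesis
    using that[OF z(1)] by simp
qed

text \<open>The logarithmic derivative minus one vanishes at \<open>0\<close> and is bounded, so by
  Schwarz it is \<open>O(1 / L)\<close> on the disk of radius \<open>8\<close>. Integrating it gives
  \<open>H1 = exp (z + W)\<close> with \<open>W = O(1 / L)\<close>.\<close>

lemma near_exp_of_near_log_derivative:
  assumes L: "512 \<le> L"
    and D: "\<And>z. z \<in> ball 0 L \<Longrightarrow> (H1 has_field_derivative H2 z) (at z)"
    and nz: "\<And>z. z \<in> ball 0 L \<Longrightarrow> H1 z \<noteq> 0"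
    and bound: "\<And>z. z \<in> ball 0 L \<Longrightarrow> cmod (H2 z) \<le> 2 * cmod (H1 z)"
    and init: "H1 0 = 1" "H2 0 = 1"
    and z: "cmod z \<le> 8"
  shows "cmod (H1 z - exp z) \<le> 3 * 10 ^ 6 / L" "cmod (exp z) \<le> 6561"
proof -
  define p where "p z = H2 z / H1 z - 1" for z
  have hol1: "H1 holomorphic_on ball 0 L"
    unfolding holomorphic_on_open[OF open_ball] using D by blast
  have "deriv H1 z = H2 z" if "z \<in> ball 0 L" for z
    using D[OF that] by (rule DERIV_imp_deriv)
  moreover have "deriv H1 holomorphic_on ball 0 L"
    using hol1 by (intro holomorphic_deriv) auto
  ultimately have hol2: "H2 holomorphic_on ball 0 L"
    using holomorphic_transform by fastforce
  have holp: "p holomorphic_on ball 0 L"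
    unfolding p_def by (intro holomorphic_intros hol1 hol2 nz)
  have p4: "cmod (p w) < 4" if "w \<in> ball 0 L" for w
  proof -
    have "cmod (p w) \<le> cmod (H2 w / H1 w) + cmod 1"
      unfolding p_def by (rule norm_triangle_ineq4)
    also have "cmod (H2 w / H1 w) \<le> 2"
      using bound[OF that] nz[OF that] by (simp add: norm_divide divide_le_eq)
    finally show ?thesis
      by simp
  qed
  have p_small: "cmod (p w) \<le> 32 / L" if "w \<in> cball 0 8" for w
  proof -
    have "cmod (p w) \<le> 4 * cmod w / L"
      by (rule Schwarz_Lemma_scaled[OF holp _ _ p4]) (use that L init in \<open>auto simp: p_def\<close>)
    also have "\<dots> \<le> 32 / L"
      using that L by (intro divide_right_mono) auto
    finally show ?thesis .
  qed
  obtain W0 where W0: "\<And>w. w \<in> ball 0 L \<Longrightarrow> (W0 has_field_derivative p w) (at w within ball 0 L)"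
    using holomorphic_convex_primitive'[OF convex_ball open_ball holp] by blast
  define W where "W w = W0 w - W0 0" for w
  have W: "(W has_field_derivative p w) (at w)" if "w \<in> ball 0 L" for w
    unfolding W_def using W0[OF that] that
    by (auto intro!: derivative_eq_intros simp: at_within_open[OF _ open_ball])
  have "((\<lambda>w. H1 w * exp (- (w + W w))) has_field_derivative 0) (at w within ball 0 L)"
    if "w \<in> ball 0 L" for w
  proof (rule has_field_derivative_at_within)
    show "((\<lambda>w. H1 w * exp (- (w + W w))) has_field_derivative 0) (at w)"
      by (rule derivative_eq_intros D[OF that] W[OF that] refl)+
         (use nz[OF that] in \<open>simp add: p_def field_simps\<close>)
  qed
  then obtain c where c: "\<And>w. w \<in> ball 0 L \<Longrightarrow> H1 w * exp (- (w + W w)) = c"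
    using has_field_derivative_zero_constant[of "ball 0 L" "\<lambda>w. H1 w * exp (- (w + W w))"] by auto
  have "c = 1"
    using c[of 0] L init by (simp add: W_def)
  have zL: "z \<in> ball 0 L"
    using z L by simp
  have H1z: "H1 z = exp z * exp (W z)"
  proof -
    have "H1 z = (H1 z * exp (- (z + W z))) * exp (z + W z)"
      by (simp add: mult.assoc flip: exp_add)
    then show ?thesis
      unfolding c[OF zL] \<open>c = 1\<close> by (simp add: exp_add)
  qed
  have "cmod (W z - W 0) \<le> 32 / L * cmod (z - 0)"
    by (rule field_differentiable_bound[OF convex_cball[of 0 8]])
       (use W p_small L z in \<open>auto intro: has_field_derivative_at_within\<close>)
  also have "\<dots> \<le> 32 / L * 8"
    using z L by (intro mult_left_mono) auto
  finally have Wz: "cmod (W z) \<le> 256 / L"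
    by (simp add: W_def)
  \<comment> \<open>The assumption \<open>512 \<le> L\<close> is exactly what this needs; smallness
    of \<open>W z\<close> allows \<open>exp (W z) - 1\<close> to be estimated linearly.\<close>
  also have "\<dots> \<le> 1 / 2"
    using L by (simp add: field_simps)
  finally have "cmod (exp (W z) - 1) \<le> 3 / 2 * cmod (W z)"
    by (rule norm_exp_bounds)
  also have "\<dots> \<le> 384 / L"
    using Wz by (simp add: field_simps)
  finally have eW: "cmod (exp (W z) - 1) \<le> 384 / L" .
  have "cmod (exp z) \<le> exp (cmod z)"
    by (rule norm_exp)
  also have "\<dots> \<le> exp 8"
    using z by simp
  \<comment> \<open>The constant \<open>6561\<close> is \<open>3 ^ 8\<close>.\<close>
  also have "exp 8 = exp (1 :: real) ^ 8"
    by (simp flip: exp_of_nat_mult)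
  also have "\<dots> \<le> 3 ^ 8"
    by (intro power_mono exp_le) auto
  finally show ez: "cmod (exp z) \<le> 6561"
    by simp
  have "H1 z - exp z = exp z * (exp (W z) - 1)"
    by (simp add: H1z algebra_simps)
  then have "cmod (H1 z - exp z) = cmod (exp z) * cmod (exp (W z) - 1)"
    by (simp add: norm_mult)
  also have "\<dots> \<le> 6561 * (384 / L)"
    by (intro mult_mono ez eW) auto
  also have "\<dots> \<le> 3 * 10 ^ 6 / L"
    using L by (simp add: field_simps)
  finally show "cmod (H1 z - exp z) \<le> 3 * 10 ^ 6 / L" .
qed

text \<open>On the disk of radius \<open>8\<close>, \<open>H - H 0\<close> is close to
  \<open>exp z - 1\<close> and \<open>G\<close> is close to \<open>k * H\<close> up to a constant,
  \<open>k\<close> being the dilatation at \<open>0\<close>. Undoing the real-linear distortion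
  caused by \<open>k\<close> leaves a small perturbation of \<open>exp z - 1\<close>, which has a
  zero near \<open>2 \<pi> \<i>\<close>: a second preimage of the value at \<open>0\<close>.\<close>

lemma harmonic_not_injective_on_large_disc:
  assumes L: "10 ^ 9 \<le> L"
    and DH: "\<And>z. z \<in> ball 0 L \<Longrightarrow> (H has_field_derivative H1 z) (at z)"
    and DH1: "\<And>z. z \<in> ball 0 L \<Longrightarrow> (H1 has_field_derivative H2 z) (at z)"
    and DG: "\<And>z. z \<in> ball 0 L \<Longrightarrow> (G has_field_derivative G1 z) (at z)"
    and jac: "\<And>z. z \<in> ball 0 L \<Longrightarrow> cmod (G1 z) < cmod (H1 z)"
    and bound: "\<And>z. z \<in> ball 0 L \<Longrightarrow> cmod (H2 z) \<le> 2 * cmod (H1 z)"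
    and init: "H1 0 = 1" "H2 0 = 1"
  shows "\<not> inj_on (\<lambda>z. H z + cnj (G z)) (ball 0 L)"
proof
  assume inj: "inj_on (\<lambda>z. H z + cnj (G z)) (ball 0 L)"
  have cball8: "z \<in> ball 0 L" if "z \<in> cball 0 8" for z :: complex
    using that L by auto
  have L0: "0 < L" "512 \<le> L"
    using L by auto
  have nz: "H1 z \<noteq> 0" if "z \<in> ball 0 L" for z
    using jac[OF that] by auto
  note near = near_exp_of_near_log_derivative[OF L0(2) DH1 nz bound init]
  have near': "cmod (H1 z - exp z) \<le> 1 / 100" if "cmod z \<le> 8" for z
  proof -
    have "3 * 10 ^ 6 / L \<le> 1 / 100"
      using L by (simp add: field_simps)
    with near(1)[OF _ _ _ that] show ?thesis
      by force
  qed
  have H1_le: "cmod (H1 z) \<le> 7000" if "cmod z \<le> 8" for z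
    using norm_triangle_sub[of "H1 z" "exp z"] near'[OF that] near(2)[OF _ _ _ that] by fastforce
  define \<omega> where "\<omega> z = G1 z / H1 z" for z
  have hol1: "H1 holomorphic_on ball 0 L"
    unfolding holomorphic_on_open[OF open_ball] using DH1 by blast
  have holG: "G holomorphic_on ball 0 L"
    unfolding holomorphic_on_open[OF open_ball] using DG by blast
  have "deriv G z = G1 z" if "z \<in> ball 0 L" for z
    using DG[OF that] by (rule DERIV_imp_deriv)
  moreover have "deriv G holomorphic_on ball 0 L"
    using holG by (intro holomorphic_deriv) auto
  ultimately have holG1: "G1 holomorphic_on ball 0 L"
    using holomorphic_transform by fastforce
  have hol\<omega>: "\<omega> holomorphic_on ball 0 L"
    unfolding \<omega>_def by (intro holomorphic_intros hol1 holG1 nz)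
  have \<omega>1: "cmod (\<omega> z) < 1" if "z \<in> ball 0 L" for z
    using jac[OF that] nz[OF that] by (simp add: \<omega>_def norm_divide)
  define k where "k = \<omega> 0"
  \<comment> \<open>This is the determinant of \<open>w \<mapsto> w + cnj k * cnj w\<close>. It has
    no positive lower bound, so every estimate for \<open>D\<close> has to carry it as a
    factor.\<close>
  define \<delta> where "\<delta> = 1 - (cmod k)\<^sup>2"
  have k1: "cmod k < 1"
    using \<omega>1 L0 by (simp add: k_def)
  then have \<delta>: "\<delta> > 0"
    by (simp add: \<delta>_def power_less_one_iff abs_square_less_1)
  define D where "D z = G z - k * H z" for z
  have D': "(D has_field_derivative (\<omega> z - k) * H1 z) (at z)" if "z \<in> ball 0 L" for z
    unfolding D_def
    by (rule derivative_eq_intros DH[OF that] DG[OF that] refl)+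
       (use nz[OF that] in \<open>simp add: \<omega>_def field_simps\<close>)
  have D'_le: "cmod ((\<omega> z - k) * H1 z) \<le> \<delta> / 1000" if "z \<in> cball 0 8" for z
  proof -
    have z8: "cmod z \<le> 8"
      using that by simp
    have "cmod (\<omega> z - k) \<le> 2 * \<delta> * cmod z / L"
      unfolding k_def \<delta>_def by (rule Schwarz_Pick_increment[OF hol\<omega> L0(1) \<omega>1]) (use z8 L in auto)
    also have "\<dots> \<le> 2 * \<delta> * 8 / L"
      using z8 \<delta> L0 by (intro divide_right_mono mult_left_mono) auto
    finally have "cmod ((\<omega> z - k) * H1 z) \<le> (2 * \<delta> * 8 / L) * 7000"
      unfolding norm_mult by (intro mult_mono H1_le z8) (use \<delta> L0 in auto)
    also have "\<dots> \<le> \<delta> / 1000"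
      using \<delta> L by (simp add: field_simps)
    finally show ?thesis .
  qed
  have D_le: "cmod (D z - D 0) \<le> \<delta> / 100" if "z \<in> cball 0 8" for z
  proof -
    have "cmod (D z - D 0) \<le> \<delta> / 1000 * cmod (z - 0)"
      by (rule field_differentiable_bound[OF convex_cball[of 0 8]])
         (use D' D'_le cball8 that in \<open>auto intro: has_field_derivative_at_within\<close>)
    also have "\<dots> \<le> \<delta> / 1000 * 8"
      using that \<delta> by (intro mult_left_mono) auto
    finally show ?thesis
      using \<delta> by simp
  qed
  have H_le: "cmod (H z - H 0 - (exp z - 1)) \<le> 8 / 100" if "z \<in> cball 0 8" for z
  proof -
    have "((\<lambda>w. H w - exp w) has_field_derivative H1 w - exp w) (at w within cball 0 8)"
      if "w \<in> cball 0 8" for w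
      by (rule has_field_derivative_at_within) (intro DERIV_diff DERIV_exp DH cball8 that)
    then have "cmod ((H z - exp z) - (H 0 - exp 0)) \<le> 1 / 100 * cmod (z - 0)"
      by (rule field_differentiable_bound[OF convex_cball[of 0 8]]) (use near' that in auto)
    also have "\<dots> \<le> 1 / 100 * 8"
      using that by (intro mult_left_mono) auto
    finally show ?thesis
      by (simp add: algebra_simps)
  qed
  \<comment> \<open>\<open>(v - cnj k * cnj v) / \<delta>\<close> inverts the real-linear map \<open>w \<mapsto> w + cnj k * cnj w\<close>, which approximately
    relates \<open>v\<close> to \<open>exp z - 1\<close>.\<close>
  define v where "v z = (H z + cnj (G z)) - (H 0 + cnj (G 0))" for z
  define E where "E z = (v z - cnj k * cnj (v z)) / of_real \<delta> - (exp z - 1)" for z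
  have kk: "of_real \<delta> = 1 - k * cnj k"
    unfolding \<delta>_def by (simp add: complex_norm_square del: of_real_power)
  have v_eq: "v z - cnj k * cnj (v z) =
      of_real \<delta> * (H z - H 0) + (cnj (D z - D 0) - cnj k * (D z - D 0))" for z
    unfolding kk v_def D_def by (simp add: algebra_simps)
  have E_le: "cmod (E z) \<le> 1 / 4" if "z \<in> cball 0 8" for z
  proof -
    have "E z = (H z - H 0 - (exp z - 1)) + (cnj (D z - D 0) - cnj k * (D z - D 0)) / of_real \<delta>"
      unfolding E_def v_eq using \<delta> by (simp add: add_divide_distrib)
    then have "cmod (E z) \<le> cmod (H z - H 0 - (exp z - 1)) +
        cmod (cnj (D z - D 0) - cnj k * (D z - D 0)) / \<delta>"
      using norm_triangle_ineq \<delta> by (metis abs_of_pos norm_divide norm_of_real)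
    also have "\<dots> \<le> 8 / 100 + (\<delta> / 100 + 1 * (\<delta> / 100)) / \<delta>"
    proof (intro add_mono H_le[OF that] divide_right_mono)
      have "cmod (cnj (D z - D 0) - cnj k * (D z - D 0)) \<le>
          cmod (cnj (D z - D 0)) + cmod (cnj k * (D z - D 0))"
        by (rule norm_triangle_ineq4)
      also have "\<dots> \<le> \<delta> / 100 + 1 * (\<delta> / 100)"
        unfolding norm_mult complex_mod_cnj
        by (intro add_mono mult_mono D_le[OF that]) (use k1 in auto)
      finally show "cmod (cnj (D z - D 0) - cnj k * (D z - D 0)) \<le> \<delta> / 100 + 1 * (\<delta> / 100)" .
    qed (use \<delta> in auto)
    also have "\<dots> \<le> 1 / 4"
      using \<delta> by (simp add: field_simps)
    finally show ?thesis .
  qed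
  \<comment> \<open>Since \<open>2 < 2 \<pi> \<le> 7\<close>, the unit disk about
    \<open>2 \<pi> \<i>\<close> lies in the disk of radius \<open>8\<close> and misses
    \<open>0\<close>; this dictates the choice of \<open>8\<close>.\<close>
  have sub: "z \<in> cball 0 8 \<and> z \<noteq> 0" if "z \<in> cball (2 * of_real pi * \<i>) 1" for z
  proof -
    have "cmod (2 * of_real pi * \<i>) = 2 * pi"
      by (simp add: norm_mult)
    moreover have "cmod (2 * of_real pi * \<i> - z) \<le> 1"
      using that by (simp add: dist_norm)
    moreover have "2 * pi \<le> 7" "2 < pi"
      using pi_approx by auto
    ultimately show ?thesis
      using norm_triangle_ineq3[of "2 * of_real pi * \<i>" z] by auto
  qed
  have "continuous_on (ball 0 L) H" "continuous_on (ball 0 L) G"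
    using DH DG by (meson DERIV_isCont continuous_at_imp_continuous_on)+
  then have "continuous_on (ball 0 L) E"
    unfolding E_def v_def using \<delta> by (intro continuous_intros) auto
  then have "continuous_on (cball (2 * of_real pi * \<i>) 1) E"
    by (rule continuous_on_subset) (use sub cball8 in blast)
  then obtain z where z: "z \<in> cball (2 * of_real pi * \<i>) 1" "exp z - 1 + E z = 0"
    using exp_perturbation_zero[of E] E_le sub by blast
  \<comment> \<open>Vanishing of \<open>exp z - 1 + E z\<close> is this equation; taking moduli with
    \<open>cmod k < 1\<close> forces \<open>v z = 0\<close>.\<close>
  have "v z = cnj k * cnj (v z)"
    using z(2) \<delta> by (simp add: E_def)
  then have "cmod (v z) = cmod k * cmod (v z)"
    by (metis complex_mod_cnj norm_mult)
  then have "v z = 0"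
    using k1 by auto
  then have "H z + cnj (G z) = H 0 + cnj (G 0)"
    by (simp add: v_def)
  then have "z = 0"
    using inj_onD[OF inj, of z 0] cball8 sub[OF z(1)] L0 by auto
  then show False
    using sub[OF z(1)] by simp
qed

section \<open>Rescaling and the bound for second derivatives\<close>

text \<open>If the bound fails, \<open>(r - cmod z) * cmod (H2 z / H1 z)\<close> has a maximum above
  \<open>2 * 10 ^ 9\<close>. Zooming in at a maximum point by the factor
  \<open>H2 z0 / H1 z0\<close> normalises that quotient to \<open>1\<close>, and maximality controls
  it by \<open>2\<close> on a disk of radius at least \<open>10 ^ 9\<close>, contradicting
  non-injectivity there. Taking \<open>r < R\<close> gives compactness.\<close>

lemma injective_harmonic_rescaled_bound:
  assumes DH: "\<And>z. z \<in> ball 0 R \<Longrightarrow> (H has_field_derivative H1 z) (at z)"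
    and DH1: "\<And>z. z \<in> ball 0 R \<Longrightarrow> (H1 has_field_derivative H2 z) (at z)"
    and DG: "\<And>z. z \<in> ball 0 R \<Longrightarrow> (G has_field_derivative G1 z) (at z)"
    and cont2: "continuous_on (ball 0 R) H2"
    and jac: "\<And>z. z \<in> ball 0 R \<Longrightarrow> cmod (G1 z) < cmod (H1 z)"
    and inj: "inj_on (\<lambda>z. H z + cnj (G z)) (ball 0 R)"
    and r: "0 < r" "r < R"
  shows "r * cmod (H2 0) \<le> 2 * 10 ^ 9 * cmod (H1 0)"
proof (rule ccontr)
  assume *: "\<not> ?thesis"
  have nz: "H1 z \<noteq> 0" if "z \<in> ball 0 R" for z
    using jac[OF that] by auto
  have sub: "z \<in> ball 0 R" if "z \<in> cball 0 r" for z :: complex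
    using that r by auto
  define P where "P z = H2 z / H1 z" for z
  define \<phi> where "\<phi> z = (r - cmod z) * cmod (P z)" for z
  have "continuous_on (ball 0 R) H1"
    using DH1 by (meson DERIV_isCont continuous_at_imp_continuous_on)
  then have "continuous_on (ball 0 R) \<phi>"
    unfolding \<phi>_def P_def by (intro continuous_intros cont2) (use nz in auto)
  then have "continuous_on (cball 0 r) \<phi>"
    by (rule continuous_on_subset) (use sub in blast)
  then obtain z0 where z0: "z0 \<in> cball 0 r" and max: "\<And>z. z \<in> cball 0 r \<Longrightarrow> \<phi> z \<le> \<phi> z0"
    using continuous_attains_sup[of "cball 0 r" \<phi>] r by auto
  have "2 * 10 ^ 9 < \<phi> 0"
    using * nz[of 0] r by (simp add: \<phi>_def P_def norm_divide field_simps)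
  also have "\<phi> 0 \<le> \<phi> z0"
    using max r by auto
  finally have m: "2 * 10 ^ 9 < \<phi> z0" .
  define \<delta> where "\<delta> = r - cmod z0"
  define K where "K = P z0"
  have \<phi>z0: "\<phi> z0 = \<delta> * cmod K"
    by (simp add: \<phi>_def \<delta>_def K_def)
  have K: "K \<noteq> 0" and \<delta>: "0 < \<delta>"
    using m z0 unfolding \<phi>z0 by (auto simp: \<delta>_def less_le)
  \<comment> \<open>For \<open>cmod w < L\<close> the point \<open>\<zeta> w\<close> stays within
    \<open>\<delta> / 2\<close> of \<open>z0\<close>, so its distance to the circle of radius
    \<open>r\<close> exceeds \<open>\<delta> / 2\<close>; this is where the factor \<open>2\<close>
    comes from.\<close>
  define L where "L = \<phi> z0 / 2"
  define \<zeta> where "\<zeta> w = z0 + w / K" for w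
  have \<zeta>': "(\<zeta> has_field_derivative 1 / K) (at w)" for w
    unfolding \<zeta>_def using K by (auto intro!: derivative_eq_intros)
  have inj\<zeta>: "inj \<zeta>"
    unfolding \<zeta>_def using K by (auto intro!: injI)
  have \<zeta>_norm: "r - cmod (\<zeta> w) > \<delta> / 2" if "w \<in> ball 0 L" for w :: complex
  proof -
    have "cmod (w / K) < \<delta> / 2"
      using that K unfolding L_def \<phi>z0 by (simp add: norm_divide field_simps)
    then show ?thesis
      using norm_triangle_ineq[of z0 "w / K"] by (simp add: \<zeta>_def \<delta>_def)
  qed
  have \<zeta>_cball: "\<zeta> w \<in> cball 0 r" if "w \<in> ball 0 L" for w :: complex
    using \<zeta>_norm[OF that] \<delta> by simp
  note \<zeta>_ball = sub[OF \<zeta>_cball]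
  have P_le: "cmod (P (\<zeta> w)) \<le> 2 * cmod K" if "w \<in> ball 0 L" for w :: complex
  proof -
    have "\<delta> / 2 * cmod (P (\<zeta> w)) \<le> \<phi> (\<zeta> w)"
      unfolding \<phi>_def by (intro mult_right_mono) (use \<zeta>_norm[OF that] in auto)
    also have "\<dots> \<le> \<delta> * cmod K"
      using max[OF \<zeta>_cball[OF that]] by (simp add: \<phi>z0)
    finally show ?thesis
      using \<delta> by (simp add: field_simps)
  qed
  have z0R: "z0 \<in> ball 0 R"
    using sub z0 by blast
  \<comment> \<open>Dividing by \<open>\<mu>\<close> makes the first two derivatives of the rescaled
    \<open>H\<close> equal to \<open>1\<close> at \<open>0\<close>. The conjugate on
    \<open>\<mu>\<close> under \<open>G\<close> makes the harmonic map as a whole a multiple of the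
    original.\<close>
  define \<mu> where "\<mu> = H1 z0 / K"
  have \<mu>: "\<mu> \<noteq> 0"
    using K nz[OF z0R] by (simp add: \<mu>_def)
  have "\<not> inj_on (\<lambda>w. H (\<zeta> w) / \<mu> + cnj (G (\<zeta> w) / cnj \<mu>)) (ball 0 L)"
  proof (rule harmonic_not_injective_on_large_disc)
    show "10 ^ 9 \<le> L"
      using m by (simp add: L_def)
    fix w :: complex assume w: "w \<in> ball 0 L"
    show "((\<lambda>w. H (\<zeta> w) / \<mu>) has_field_derivative H1 (\<zeta> w) / H1 z0) (at w)"
      by (rule DERIV_cong[OF DERIV_cdivide[OF DERIV_chain2[OF DH[OF \<zeta>_ball[OF w]] \<zeta>']]])
         (use K in \<open>simp add: \<mu>_def\<close>)
    show "((\<lambda>w. H1 (\<zeta> w) / H1 z0) has_field_derivative H2 (\<zeta> w) / (K * H1 z0)) (at w)"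
      by (rule DERIV_cong[OF DERIV_cdivide[OF DERIV_chain2[OF DH1[OF \<zeta>_ball[OF w]] \<zeta>']]])
         simp
    show "((\<lambda>w. G (\<zeta> w) / cnj \<mu>) has_field_derivative G1 (\<zeta> w) / (K * cnj \<mu>)) (at w)"
      by (rule DERIV_cong[OF DERIV_cdivide[OF DERIV_chain2[OF DG[OF \<zeta>_ball[OF w]] \<zeta>']]])
         simp
    show "cmod (G1 (\<zeta> w) / (K * cnj \<mu>)) < cmod (H1 (\<zeta> w) / H1 z0)"
      using jac[OF \<zeta>_ball[OF w]] K nz[OF z0R]
      by (simp add: norm_divide norm_mult \<mu>_def divide_strict_right_mono)
    show "cmod (H2 (\<zeta> w) / (K * H1 z0)) \<le> 2 * cmod (H1 (\<zeta> w) / H1 z0)"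
      using P_le[OF w] K nz[OF z0R] nz[OF \<zeta>_ball[OF w]]
      by (simp add: P_def norm_divide norm_mult field_simps)
  qed (use K nz[OF z0R] in \<open>auto simp: \<zeta>_def K_def P_def\<close>)
  moreover have "inj_on (\<lambda>w. H (\<zeta> w) / \<mu> + cnj (G (\<zeta> w) / cnj \<mu>)) (ball 0 L)"
  proof (rule inj_onI)
    fix w w' :: complex assume w: "w \<in> ball 0 L" "w' \<in> ball 0 L"
      and "H (\<zeta> w) / \<mu> + cnj (G (\<zeta> w) / cnj \<mu>) = H (\<zeta> w') / \<mu> + cnj (G (\<zeta> w') / cnj \<mu>)"
    then have "H (\<zeta> w) + cnj (G (\<zeta> w)) = H (\<zeta> w') + cnj (G (\<zeta> w'))"
      using \<mu> by (simp flip: add_divide_distrib)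
    then have "\<zeta> w = \<zeta> w'"
      using inj_onD[OF inj] \<zeta>_ball w by blast
    then show "w = w'"
      using inj\<zeta> by (simp add: inj_eq)
  qed
  ultimately show False
    by blast
qed

text \<open>The term with \<open>H\<close> follows by letting the inner radius tend to
  \<open>R\<close>. For \<open>G\<close>, differentiate \<open>deriv G = \<omega> * deriv H\<close>,
  where \<open>\<omega>\<close> is bounded by \<open>1\<close>, and bound
  \<open>deriv \<omega> 0\<close> by Cauchy's inequality on the disk of radius
  \<open>R / 2\<close>.\<close>

lemma injective_harmonic_sense_preserving_second_deriv_bound:
  assumes H: "H holomorphic_on ball 0 R" and G: "G holomorphic_on ball 0 R" and R: "0 < R"
    and jac: "\<And>z. z \<in> ball 0 R \<Longrightarrow> cmod (deriv G z) < cmod (deriv H z)"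
    and inj: "inj_on (\<lambda>z. H z + cnj (G z)) (ball 0 R)"
  shows "R * (cmod (deriv (deriv H) 0) + cmod (deriv (deriv G) 0)) \<le> 10 ^ 10 * cmod (deriv H 0)"
proof -
  have H1: "deriv H holomorphic_on ball 0 R" and G1: "deriv G holomorphic_on ball 0 R"
    by (intro holomorphic_deriv H G open_ball)+
  have H2_interior: "t * R * cmod (deriv (deriv H) 0) \<le> 2 * 10 ^ 9 * cmod (deriv H 0)" if "0 < t" "t < 1" for t
  proof (rule injective_harmonic_rescaled_bound[OF _ _ _ _ jac inj])
    show "continuous_on (ball 0 R) (deriv (deriv H))"
      by (intro holomorphic_on_imp_continuous_on holomorphic_deriv H open_ball)
    show "0 < t * R" "t * R < R"
      using that R by simp_all
  qed (rule holomorphic_derivI[OF H open_ball] holomorphic_derivI[OF G open_ball]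
        holomorphic_derivI[OF H1 open_ball], assumption)+
  have H2: "R * cmod (deriv (deriv H) 0) \<le> 2 * 10 ^ 9 * cmod (deriv H 0)"
  proof (rule field_le_mult_one_interval)
    show "t * (R * cmod (deriv (deriv H) 0)) \<le> 2 * 10 ^ 9 * cmod (deriv H 0)" if "0 < t" "t < 1" for t
      using H2_interior[OF that] by (simp add: mult.assoc)
  qed
  have nz: "deriv H z \<noteq> 0" if "z \<in> ball 0 R" for z
    using jac[OF that] by auto
  have in0: "0 \<in> ball 0 R"
    using R by simp
  define \<omega> where "\<omega> z = deriv G z / deriv H z" for z
  have \<omega>: "\<omega> holomorphic_on ball 0 R"
    unfolding \<omega>_def by (intro holomorphic_on_divide H1 G1 nz)
  have \<omega>1: "cmod (\<omega> z) \<le> 1" if "z \<in> ball 0 R" for z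
    using jac[OF that] nz[OF that] by (simp add: \<omega>_def norm_divide)
  have "cmod ((deriv ^^ 1) \<omega> 0) \<le> fact 1 * 1 / (R / 2) ^ 1"
  proof (rule Cauchy_inequality)
    show "\<omega> holomorphic_on ball 0 (R / 2)"
      using \<omega> by (rule holomorphic_on_subset) (use R in auto)
    show "continuous_on (cball 0 (R / 2)) \<omega>"
      using holomorphic_on_imp_continuous_on[OF \<omega>] by (rule continuous_on_subset) (use R in auto)
  qed (use \<omega>1 R in auto)
  then have \<omega>': "cmod (deriv \<omega> 0) \<le> 2 / R"
    using R by simp
  have "(\<omega> has_field_derivative
      (deriv (deriv G) 0 * deriv H 0 - deriv G 0 * deriv (deriv H) 0) / (deriv H 0 * deriv H 0)) (at 0)"
    unfolding \<omega>_def
    by (rule DERIV_divide holomorphic_derivI[OF H1 open_ball in0] holomorphic_derivI[OF G1 open_ball in0] nz[OF in0])+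
  then have "deriv \<omega> 0 =
      (deriv (deriv G) 0 * deriv H 0 - deriv G 0 * deriv (deriv H) 0) / (deriv H 0 * deriv H 0)"
    by (rule DERIV_imp_deriv)
  then have "deriv (deriv G) 0 = deriv \<omega> 0 * deriv H 0 + \<omega> 0 * deriv (deriv H) 0"
    using nz[OF in0] by (simp add: \<omega>_def field_simps)
  then have "cmod (deriv (deriv G) 0) \<le>
      cmod (deriv \<omega> 0) * cmod (deriv H 0) + cmod (\<omega> 0) * cmod (deriv (deriv H) 0)"
    using norm_triangle_ineq by (metis norm_mult)
  also have "\<dots> \<le> 2 / R * cmod (deriv H 0) + 1 * cmod (deriv (deriv H) 0)"
    by (intro add_mono mult_right_mono \<omega>' \<omega>1 in0) auto
  finally have "R * cmod (deriv (deriv G) 0) \<le> 2 * cmod (deriv H 0) + R * cmod (deriv (deriv H) 0)"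
    using R by (simp add: field_simps)
  then have "R * (cmod (deriv (deriv H) 0) + cmod (deriv (deriv G) 0)) \<le> (2 + 4 * 10 ^ 9) * cmod (deriv H 0)"
    using H2 by (simp add: distrib_left)
  also have "\<dots> \<le> 10 ^ 10 * cmod (deriv H 0)"
    by (rule mult_right_mono) auto
  finally show ?thesis .
qed

text \<open>By Lewy's theorem and connectedness the Jacobian has constant sign. If it is negative,
  conjugating the map exchanges \<open>H\<close> and \<open>G\<close>; the symmetric right-hand side
  covers both cases.\<close>

lemma injective_harmonic_second_deriv_bound:
  assumes H: "H holomorphic_on ball 0 R" and G: "G holomorphic_on ball 0 R" and R: "0 < R"
    and inj: "inj_on (\<lambda>z. H z + cnj (G z)) (ball 0 R)"
  shows "R * (cmod (deriv (deriv H) 0) + cmod (deriv (deriv G) 0))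
           \<le> 10 ^ 10 * (cmod (deriv H 0) + cmod (deriv G 0))"
proof -
  let ?J = "\<lambda>z. cmod (deriv H z) - cmod (deriv G z)"
  have J: "?J z \<noteq> 0" if "z \<in> ball 0 R" for z
    using injective_harmonic_jacobian_nonzero[OF H G open_ball that inj] by simp
  have "continuous_on (ball 0 R) ?J"
    by (intro continuous_intros holomorphic_on_imp_continuous_on holomorphic_deriv H G open_ball)
  then have conn: "connected (?J ` ball 0 R)"
    by (intro connected_continuous_image) auto
  have "0 \<in> ?J ` ball 0 R" if "z \<in> ball 0 R" "w \<in> ball 0 R" "?J z \<le> 0" "0 \<le> ?J w" for z w
    using connectedD_interval[OF conn, of "?J z" "?J w" 0] that by blast
  then have no_change: False if "z \<in> ball 0 R" "w \<in> ball 0 R" "?J z \<le> 0" "0 \<le> ?J w" for z w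
    using J that by force
  consider "\<forall>z\<in>ball 0 R. ?J z > 0" | "\<forall>z\<in>ball 0 R. ?J z < 0"
    using no_change by (meson not_less)
  then show ?thesis
  proof cases
    case 1
    have "R * (cmod (deriv (deriv H) 0) + cmod (deriv (deriv G) 0)) \<le> 10 ^ 10 * cmod (deriv H 0)"
      by (rule injective_harmonic_sense_preserving_second_deriv_bound[OF H G R _ inj])
         (use 1 in force)
    also have "\<dots> \<le> 10 ^ 10 * (cmod (deriv H 0) + cmod (deriv G 0))"
      by simp
    finally show ?thesis .
  next
    case 2
    have inj': "inj_on (\<lambda>z. G z + cnj (H z)) (ball 0 R)"
    proof (rule inj_onI)
      fix z w assume zw: "z \<in> ball 0 R" "w \<in> ball 0 R" and "G z + cnj (H z) = G w + cnj (H w)"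
      then have "cnj (G z + cnj (H z)) = cnj (G w + cnj (H w))"
        by simp
      then have "H z + cnj (G z) = H w + cnj (G w)"
        by (simp add: add.commute)
      then show "z = w"
        using inj_onD[OF inj] zw by blast
    qed
    have "R * (cmod (deriv (deriv G) 0) + cmod (deriv (deriv H) 0)) \<le> 10 ^ 10 * cmod (deriv G 0)"
      by (rule injective_harmonic_sense_preserving_second_deriv_bound[OF G H R _ inj'])
         (use 2 in force)
    also have "\<dots> \<le> 10 ^ 10 * (cmod (deriv H 0) + cmod (deriv G 0))"
      by simp
    finally show ?thesis
      by (simp only: add.commute)
  qed
qed

section \<open>Coefficient decay and order\<close>

text \<open>The normalised quantity \<open>e n\<close> is eventually non-increasing, hence bounded;
  this is the claimed decay rewritten.\<close>

lemma decay_of_ratio_bound: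
  fixes d :: "nat \<Rightarrow> real"
  assumes nonneg: "\<And>n. 0 \<le> d n" and s: "0 < s" and C: "0 < C"
    and ratio: "\<And>n. n \<ge> N \<Longrightarrow> real n powr (s - 1) * d (n + 2) \<le> C * d (n + 1)"
  shows "\<exists>K>0. \<exists>B>0. \<forall>n. d n / fact n \<le> K * B ^ n / fact n powr s"
proof -
  define B where "B = C * 3 powr s"
  have B: "0 < B"
    using C by (simp add: B_def)
  have cancel: "(b * x * p) * (y / (p * z * (b * w))) = x / z * y / w"
    if "p \<noteq> 0" "b \<noteq> 0" for b p w x y z :: real
    using that by (simp add: field_simps)
  define e where "e n = d n / fact n * fact n powr s / B ^ n" for n
  have step: "e (Suc m) \<le> e m" if m: "m \<ge> N + 2" for m
  proof -
    define x where "x = real (m - 1)"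
    \<comment> \<open>The ratio hypothesis at \<open>m - 1\<close> compares \<open>d (m + 1)\<close>
      with \<open>d m\<close>. For \<open>m \<ge> 2\<close>, replacing \<open>m - 1\<close> by
      \<open>m + 1\<close> costs at most a factor \<open>3\<close>, which \<open>B\<close> absorbs
      as \<open>3 powr s\<close>.\<close>
    have x: "x \<ge> 1" "real m + 1 \<le> 3 * x" "x \<le> real m + 1"
      using m by (auto simp: x_def of_nat_diff)
    have "x powr (s - 1) * d (Suc m) \<le> C * d m"
      using ratio[of "m - 1"] m by (simp add: x_def numeral_2_eq_2)
    \<comment> \<open>The exponent \<open>s - 1\<close> may be negative; multiplying by
      \<open>x\<close> gives the exponent \<open>s\<close>, for which the power is monotone.\<close>
    then have r1: "x powr s * d (Suc m) \<le> C * x * d m"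
      using x by (simp add: powr_diff field_simps)
    have "(real m + 1) powr s * d (Suc m) \<le> (3 * x) powr s * d (Suc m)"
      using x s nonneg by (intro mult_right_mono powr_mono2) auto
    also have "\<dots> = 3 powr s * (x powr s * d (Suc m))"
      using x by (simp add: powr_mult)
    also have "\<dots> \<le> 3 powr s * (C * x * d m)"
      by (intro mult_left_mono r1) auto
    also have "\<dots> = B * d m * x"
      by (simp add: B_def)
    also have "\<dots> \<le> B * d m * (real m + 1)"
      using x B nonneg by (intro mult_left_mono) auto
    finally have r2: "(real m + 1) powr s * d (Suc m) \<le> B * d m * (real m + 1)" .
    have f: "fact (Suc m) = (real m + 1) * fact m" "(fact (Suc m) :: real) powr s = (real m + 1) powr s * fact m powr s"
      by (simp_all add: powr_mult add.commute)
    have "e (Suc m) = ((real m + 1) powr s * d (Suc m)) * (fact m powr s / ((real m + 1) * fact m * B ^ Suc m))"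
      unfolding e_def f(2) unfolding f(1) by simp
    also have "\<dots> \<le> (B * d m * (real m + 1)) * (fact m powr s / ((real m + 1) * fact m * B ^ Suc m))"
      using B by (intro mult_right_mono r2) auto
    also have "\<dots> = e m"
      unfolding e_def power_Suc by (rule cancel) (use B in auto)
    finally show ?thesis .
  qed
  \<comment> \<open>The added \<open>1\<close> keeps \<open>K\<close> positive even if the maximum
    is \<open>0\<close>.\<close>
  define K where "K = Max (e ` {..N + 2}) + 1"
  have le_K: "e n \<le> K" if "n \<le> N + 2" for n
  proof -
    have "e n \<le> Max (e ` {..N + 2})"
      using that by (intro Max_ge) auto
    then show ?thesis
      by (simp add: K_def)
  qed
  have eK: "e n \<le> K" for n
  proof (cases "n \<le> N + 2")
    case False
    then have "N + 2 \<le> n"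
      by simp
    then show ?thesis
    proof (induction n rule: dec_induct)
      case base
      show ?case by (rule le_K) simp
    next
      case (step m)
      then show ?case
        using \<open>\<And>m. m \<ge> N + 2 \<Longrightarrow> e (Suc m) \<le> e m\<close> order_trans by blast
    qed
  qed (rule le_K)
  have "0 \<le> e 0"
    using nonneg by (simp add: e_def)
  also have "e 0 < K"
  proof -
    have "e 0 \<le> Max (e ` {..N + 2})"
      by (intro Max_ge) auto
    then show ?thesis
      unfolding K_def by linarith
  qed
  finally have "0 < K" .
  moreover have "d n / fact n \<le> K * B ^ n / fact n powr s" for n
    using eK[of n] B by (simp add: e_def field_simps)
  ultimately show ?thesis
    using B by blast
qed

lemma power_div_fact_le_exp:
  fixes x :: real
  assumes "0 \<le> x"
  shows "x ^ n / fact n \<le> exp x"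
proof -
  have sums: "(\<lambda>k. x ^ k / fact k) sums exp x"
    using exp_converges[of x] by (simp add: field_simps)
  have "x ^ n / fact n = (\<Sum>k\<in>{n}. x ^ k / fact k)"
    by simp
  also have "\<dots> \<le> exp x"
    unfolding sums_unique[OF sums]
    by (rule sum_le_suminf) (use sums assms in \<open>auto simp: sums_iff\<close>)
  finally show ?thesis .
qed

text \<open>With \<open>x powr s = 2 * B * r\<close>, each term is at most
  \<open>K * (x ^ n / fact n) powr s / 2 ^ n\<close>, and \<open>x ^ n / fact n \<le> exp x\<close>.
  The \<open>2\<close> in \<open>2 * B\<close> pays for a geometric series.\<close>

lemma exponential_growth_of_coefficient_decay:
  fixes c :: "nat \<Rightarrow> complex"
  assumes sums: "\<And>z. (\<lambda>n. c n * z ^ n) sums h z"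
    and s: "0 < s" and K: "0 < K" and B: "0 < B"
    and c: "\<And>n. cmod (c n) \<le> K * B ^ n / fact n powr s"
  shows "cmod (h z) \<le> 2 * K * exp (s * (2 * B) powr (1 / s) * cmod z powr (1 / s))"
proof -
  define r where "r = cmod z"
  define x where "x = (2 * B * r) powr (1 / s)"
  define E where "E = exp (s * x)"
  have r: "0 \<le> r" and x: "0 \<le> x"
    by (auto simp: r_def x_def)
  have xs: "x powr s = 2 * B * r"
    using s B r by (simp add: x_def powr_powr)
  have term_le: "cmod (c n * z ^ n) \<le> K * E * (1 / 2) ^ n" for n
  proof -
    have "(2 * B * r) ^ n / fact n powr s = (x ^ n / fact n) powr s"
    proof -
      have "(x ^ n / fact n) powr s = (x ^ n) powr s / fact n powr s"
        using x by (simp add: powr_divide)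
      also have "(x ^ n) powr s = (x powr s) ^ n"
      \<comment> \<open>Converting \<open>powr\<close> to an integer power requires a positive base,
        so \<open>x = 0\<close> is treated apart.\<close>
      proof (cases "x = 0")
        case True
        then show ?thesis
          by (cases n) simp_all
      next
        case False
        with x have "0 < x"
          by simp
        then have "(x ^ n) powr s = (x powr s) powr real n"
          by (simp add: powr_powr mult.commute flip: powr_realpow)
        also have "\<dots> = (x powr s) ^ n"
          using \<open>0 < x\<close> by (intro powr_realpow) simp
        finally show ?thesis .
      qed
      finally show ?thesis
        by (simp add: xs)
    qed
    also have "\<dots> \<le> exp x powr s"
      by (intro powr_mono2 power_div_fact_le_exp) (use s x in auto)
    also have "\<dots> = E"
      by (simp add: E_def powr_def mult.commute)
    finally have *: "(2 * B * r) ^ n / fact n powr s \<le> E" .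
    have "cmod (c n * z ^ n) \<le> K * B ^ n / fact n powr s * r ^ n"
      unfolding norm_mult norm_power r_def by (intro mult_right_mono c) auto
    also have "\<dots> = K * (1 / 2) ^ n * ((2 * B * r) ^ n / fact n powr s)"
      by (simp add: power_mult_distrib power_divide)
    also have "\<dots> \<le> K * (1 / 2) ^ n * E"
      by (intro mult_left_mono *) (use K in auto)
    finally show ?thesis
      by (simp add: mult_ac)
  qed
  have geo: "(\<lambda>n. K * E * (1 / 2) ^ n) sums (K * E * 2)"
    using sums_mult[OF geometric_sums[of "1 / 2 :: real"], of "K * E"] by simp
  have "cmod (\<Sum>n. c n * z ^ n) \<le> (\<Sum>n. K * E * (1 / 2) ^ n)"
    by (rule norm_suminf_le[OF term_le]) (use geo in \<open>simp add: sums_iff\<close>)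
  then have "cmod (h z) \<le> K * E * 2"
    using geo sums[of z] by (simp add: sums_iff)
  then show ?thesis
    using B r by (simp add: E_def x_def r_def powr_mult mult_ac)
qed

section \<open>Maximum modulus and order of growth\<close>

lemma
  assumes "continuous_on UNIV f"
  shows norm_le_max_modulus: "cmod (f z) \<le> max_modulus f (cmod z)"
    and max_modulus_le: "0 \<le> r \<Longrightarrow> (\<And>z. cmod z = r \<Longrightarrow> cmod (f z) \<le> B) \<Longrightarrow> max_modulus f r \<le> B"
proof -
  have "compact ((\<lambda>z. cmod (f z)) ` sphere 0 (cmod z))"
    by (intro compact_continuous_image continuous_intros continuous_on_subset[OF assms]) auto
  then have "bdd_above ((\<lambda>z. cmod (f z)) ` sphere 0 (cmod z))"
    by (intro bounded_imp_bdd_above compact_imp_bounded)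
  then show "cmod (f z) \<le> max_modulus f (cmod z)"
    unfolding max_modulus_def by (rule cSUP_upper2[of _ _ z]) auto
  show "max_modulus f r \<le> B" if "0 \<le> r" "\<And>z. cmod z = r \<Longrightarrow> cmod (f z) \<le> B"
    unfolding max_modulus_def by (rule cSUP_least) (use that in auto)
qed

text \<open>The maximum principle spreads the bound from the circles to the plane; then
  \<open>exp \<circ> \<phi>\<close> is bounded and Liouville applies. Only some arbitrarily large
  circles are available, because the lemma is applied to the negation of an eventual
  statement.\<close>

lemma holomorphic_Re_bounded_above_on_circles_constant:
  assumes hol: "\<phi> holomorphic_on UNIV"
    and bound: "\<And>r0. \<exists>r\<ge>r0. \<forall>z. cmod z = r \<longrightarrow> Re (\<phi> z) \<le> B"
  shows "\<phi> z = \<phi> 0"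
proof -
  have Re_le: "Re (\<phi> w) \<le> B" for w
  proof -
    obtain r where r: "r \<ge> cmod w + 1" "\<And>z. cmod z = r \<Longrightarrow> Re (\<phi> z) \<le> B"
      using bound by blast
    have r0: "0 < r"
      using r(1) norm_ge_zero[of w] by linarith
    show ?thesis
    proof (rule maximum_real_frontier[of \<phi> "ball 0 r"])
      show "\<phi> holomorphic_on interior (ball 0 r)" "continuous_on (closure (ball 0 r)) \<phi>"
        using hol holomorphic_on_imp_continuous_on holomorphic_on_subset continuous_on_subset
        by (metis subset_UNIV)+
    qed (use r r0 in auto)
  qed
  have "(\<lambda>w. exp (\<phi> w)) holomorphic_on UNIV"
    by (intro holomorphic_intros hol)
  moreover have "bounded (range (\<lambda>w. exp (\<phi> w)))"
    unfolding bounded_iff using Re_le by (intro exI[of _ "exp B"]) auto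
  ultimately have "(\<lambda>w. exp (\<phi> w)) constant_on UNIV"
    by (rule Liouville_theorem)
  then obtain k where k: "(\<lambda>w. exp (\<phi> w)) = (\<lambda>_. k)"
    unfolding constant_on_def by auto
  have "(\<phi> has_field_derivative 0) (at w)" for w
  proof -
    have D: "(\<phi> has_field_derivative deriv \<phi> w) (at w)"
      using hol holomorphic_derivI by blast
    have "((\<lambda>w. exp (\<phi> w)) has_field_derivative exp (\<phi> w) * deriv \<phi> w) (at w)"
      by (rule DERIV_chain2[OF DERIV_exp D])
    moreover have "((\<lambda>w. exp (\<phi> w)) has_field_derivative 0) (at w)"
      unfolding k by simp
    ultimately have "deriv \<phi> w = 0"
      using DERIV_unique by fastforce
    with D show ?thesis
      by simp
  qed
  then show ?thesis
    using has_field_derivative_zero_constant[of UNIV \<phi>] by auto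
qed

lemma harmonic_entire_continuous:
  "harmonic_entire_mapping f h g \<Longrightarrow> continuous_on UNIV f"
proof -
  assume "harmonic_entire_mapping f h g"
  then have "h holomorphic_on UNIV" "g holomorphic_on UNIV" and f: "f = (\<lambda>z. h z + cnj (g z))"
    by (auto simp: harmonic_entire_mapping_def)
  then show ?thesis
    unfolding f by (intro continuous_intros holomorphic_on_imp_continuous_on)
qed

text \<open>This gives the nested logarithms in \<open>growth_order\<close> their usual meaning.
  Otherwise \<open>c * h + cnj c * g\<close>, whose real part is that of \<open>c * f\<close>, is
  constant for every unimodular \<open>c\<close>; the choices \<open>1\<close> and
  \<open>\<i>\<close> then make \<open>h\<close> and \<open>g\<close> constant.\<close>

lemma transcendental_max_modulus_large:
  assumes "transcendental_harmonic_entire_mapping f h g"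
  shows "eventually (\<lambda>r. B < max_modulus f r) at_top"
proof (rule ccontr)
  assume not: "\<not> ?thesis"
  have mapping: "harmonic_entire_mapping f h g"
    using assms by (simp add: transcendental_harmonic_entire_mapping_def)
  then have h: "h holomorphic_on UNIV" and g: "g holomorphic_on UNIV" and f: "\<And>z. f z = h z + cnj (g z)"
    by (auto simp: harmonic_entire_mapping_def)
  have circles: "\<exists>r\<ge>r0. \<forall>z. cmod z = r \<longrightarrow> cmod (f z) \<le> B" for r0
  proof -
    obtain r where "r \<ge> r0" "max_modulus f r \<le> B"
      using not by (auto simp: eventually_at_top_linorder not_less)
    then show ?thesis
      using norm_le_max_modulus[OF harmonic_entire_continuous[OF mapping]] by (metis order_trans)
  qed
  have const: "c * h z + cnj c * g z = c * h 0 + cnj c * g 0" if "cmod c = 1" for c z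
  proof (rule holomorphic_Re_bounded_above_on_circles_constant[where B = B])
    show "(\<lambda>z. c * h z + cnj c * g z) holomorphic_on UNIV"
      by (intro holomorphic_intros h g)
    fix r0
    have "Re (c * h z + cnj c * g z) \<le> cmod (f z)" for z
    proof -
      have "Re (c * h z + cnj c * g z) = Re (c * f z)"
        by (simp add: f algebra_simps)
      also have "\<dots> \<le> cmod (c * f z)"
        by (rule complex_Re_le_cmod)
      finally show ?thesis
        using that by (simp add: norm_mult)
    qed
    then show "\<exists>r\<ge>r0. \<forall>z. cmod z = r \<longrightarrow> Re (c * h z + cnj c * g z) \<le> B"
      using circles[of r0] by (metis order_trans)
  qed
  have sum: "h z + g z = h 0 + g 0" and diff: "h z - g z = h 0 - g 0" for z
  proof -
    show "h z + g z = h 0 + g 0"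
      using const[of 1 z] by simp
    have "\<i> * (h z - g z) = \<i> * (h 0 - g 0)"
      using const[of \<i> z] by (simp add: algebra_simps)
    then show "h z - g z = h 0 - g 0"
      by simp
  qed
  have "h z = h 0 \<and> g z = g 0" for z
  proof -
    have "2 * h z = 2 * h 0"
      using arg_cong2[OF sum diff, of "(+)" z z] by simp
    then show ?thesis
      using sum[of z] by simp
  qed
  then have "h z = poly [:h 0:] z" "g z = poly [:g 0:] z" for z
    by simp_all
  then have "is_polynomial h" "is_polynomial g"
    unfolding is_polynomial_def by blast+
  then show False
    using assms by (simp add: transcendental_harmonic_entire_mapping_def)
qed

lemma growth_order_nonneg:
  assumes "eventually (\<lambda>r. exp 1 < max_modulus f r) at_top"
  shows "0 \<le> growth_order f"
proof -
  have "eventually (\<lambda>r. 0 \<le> ereal (ln (ln (max_modulus f r)) / ln r)) at_top"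
    using assms eventually_gt_at_top[of 1]
  proof eventually_elim
    case (elim r)
    then have "1 \<le> ln (max_modulus f r)"
      by (metis exp_gt_zero less_imp_le less_trans ln_ge_iff)
    with elim show ?case
      by (simp add: zero_ereal_def)
  qed
  then have "Liminf at_top (\<lambda>r. ereal (ln (ln (max_modulus f r)) / ln r)) \<ge> 0"
    by (intro Liminf_bounded)
  then show ?thesis
    unfolding growth_order_def
    using Liminf_le_Limsup[of "at_top :: real filter"] order_trans by (metis trivial_limit_at_top_linorder)
qed

lemma growth_order_le:
  assumes cont: "continuous_on UNIV f"
    and large: "eventually (\<lambda>r. exp 1 < max_modulus f r) at_top"
    and A: "0 < A" and B: "0 < B" and \<tau>: "0 < \<tau>"
    and bound: "\<And>z. cmod (f z) \<le> A * exp (B * cmod z powr \<tau>)"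
  shows "growth_order f \<le> ereal \<tau>"
proof -
  have "filterlim (\<lambda>r. r powr \<tau>) at_top at_top"
    using \<tau> by real_asymp
  \<comment> \<open>The constant \<open>A\<close> is absorbed by raising \<open>B\<close> to
    \<open>B + 1\<close>, which disappears after the second logarithm and division by
    \<open>ln r\<close>.\<close>
  then have "eventually (\<lambda>r. ln A \<le> r powr \<tau>) at_top"
    by (simp add: filterlim_at_top)
  then have "eventually (\<lambda>r. ereal (ln (ln (max_modulus f r)) / ln r) \<le> ereal (ln (B + 1) / ln r + \<tau>)) at_top"
    using large eventually_gt_at_top[of 1]
  proof eventually_elim
    case (elim r)
    have "max_modulus f r \<le> A * exp (B * r powr \<tau>)"
      using elim bound by (intro max_modulus_le cont) auto
    moreover have pos: "0 < max_modulus f r"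
      using elim(2) exp_gt_zero less_trans by blast
    ultimately have "ln (max_modulus f r) \<le> ln (A * exp (B * r powr \<tau>))"
      by simp
    also have "\<dots> = ln A + B * r powr \<tau>"
      using A by (simp add: ln_mult)
    also have "\<dots> \<le> (B + 1) * r powr \<tau>"
      using elim by (simp add: algebra_simps)
    finally have le: "ln (max_modulus f r) \<le> (B + 1) * r powr \<tau>" .
    have "1 \<le> ln (max_modulus f r)"
      using elim(2) pos by (simp add: ln_ge_iff)
    then have "ln (ln (max_modulus f r)) \<le> ln ((B + 1) * r powr \<tau>)"
      using le by simp
    also have "\<dots> = ln (B + 1) + \<tau> * ln r"
      using B elim by (simp add: ln_mult ln_powr)
    finally show ?case
      using elim by (simp add: field_simps)
  qed
  then have "growth_order f \<le> Limsup at_top (\<lambda>r. ereal (ln (B + 1) / ln r + \<tau>))"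
    unfolding growth_order_def by (rule Limsup_mono)
  also have "((\<lambda>r. ln (B + 1) / ln r + \<tau>) \<longlongrightarrow> 0 + \<tau>) at_top"
    by (intro tendsto_add tendsto_divide_0[OF tendsto_const] tendsto_const
        filterlim_at_top_imp_at_infinity ln_at_top)
  then have "Limsup at_top (\<lambda>r. ereal (ln (B + 1) / ln r + \<tau>)) = ereal \<tau>"
    by (intro lim_imp_Limsup) (auto intro: tendsto_ereal)
  finally show ?thesis .
qed

section \<open>From radii of univalence to the order\<close>

lemma inj_on_ball_less_radius_of_univalence:
  assumes "ereal r < radius_of_univalence F"
  shows "inj_on F (ball 0 r)"
proof -
  obtain R where "inj_on F (eball 0 R)" "ereal r < R"
    using assms unfolding radius_of_univalence_def less_Sup_iff by blast
  moreover from this have "ball 0 r \<subseteq> eball 0 R"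
    by (auto simp: eball_def) (metis dist_0_norm less_ereal.simps(1) less_trans)
  ultimately show ?thesis
    using inj_on_subset by blast
qed

text \<open>As \<open>s > 0\<close>, \<open>n powr s\<close> is at least \<open>1\<close>, so the
  maximum with \<open>1\<close> cannot account for the large logarithm; \<open>n \<ge> 2\<close>
  makes \<open>ln n\<close> positive.\<close>

lemma radius_gt_of_log_ratio_gt:
  assumes n: "2 \<le> n" and s: "0 < s"
    and gt: "ereal s < ln_ereal (max 1 (ereal (real n) * R)) / ereal (ln (real n))"
  shows "ereal (real n powr (s - 1)) < R"
proof (rule ccontr)
  assume "\<not> ?thesis"
  then have "ereal (real n) * R \<le> ereal (real n) * ereal (real n powr (s - 1))"
    by (intro ereal_mult_left_mono) auto
  also have "\<dots> = ereal (real n powr s)"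
    using n by (simp add: powr_diff)
  finally have "max 1 (ereal (real n) * R) \<le> ereal (real n powr s)"
    using n s ge_one_powr_ge_zero[of "real n" s] by (simp add: one_ereal_def)
  moreover have "1 \<le> max 1 (ereal (real n) * R)"
    by simp
  ultimately have "\<exists>x. X = ereal x \<and> 1 \<le> x \<and> x \<le> real n powr s"
    if "X = max 1 (ereal (real n) * R)" for X
    unfolding that[symmetric] by (cases X) (auto simp: one_ereal_def)
  then obtain x where x: "max 1 (ereal (real n) * R) = ereal x" "1 \<le> x" "x \<le> real n powr s"
    by blast
  have "ln x \<le> s * ln (real n)"
    using x n ln_mono[of x "real n powr s"] by (simp add: ln_powr)
  then have "ln x / ln (real n) \<le> s"
    using n by (simp add: divide_le_eq)
  moreover have "ereal s < ereal (ln x / ln (real n))"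
    using gt x n unfolding x(1) by (simp add: ln_ereal_def)
  ultimately show False
    by simp
qed

theorem theorem6:
  fixes f h g :: "complex \<Rightarrow> complex"
    and a b :: "nat \<Rightarrow> complex"
    and \<rho> :: ereal
    and R :: "nat \<Rightarrow> ereal"
  assumes "transcendental_harmonic_entire_mapping f h g"
    and "\<And>z. (\<lambda>k. a k * z ^ k) sums h z"
    and "\<And>z. (\<lambda>k. b (Suc k) * z ^ Suc k) sums g z"
    and "\<rho> = growth_order f"
    and "\<And>n. R n = radius_of_univalence (harmonic_nth_deriv h g n)"
  shows "Liminf sequentially
           (\<lambda>n. ln_ereal (max 1 (ereal (real n) * R n)) / ereal (ln (real n)))
         \<le> 1 / \<rho>"
proof (rule ccontr)
  let ?L = "\<lambda>n. ln_ereal (max 1 (ereal (real n) * R n)) / ereal (ln (real n))"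
  assume "\<not> Liminf sequentially ?L \<le> 1 / \<rho>"
  then have less: "1 / \<rho> < Liminf sequentially ?L"
    by simp
  have mapping: "harmonic_entire_mapping f h g"
    using assms(1) by (simp add: transcendental_harmonic_entire_mapping_def)
  then have h: "h holomorphic_on UNIV" and g: "g holomorphic_on UNIV" and f: "\<And>z. f z = h z + cnj (g z)"
    by (auto simp: harmonic_entire_mapping_def)
  have cont: "continuous_on UNIV f"
    using harmonic_entire_continuous[OF mapping] .
  have large: "eventually (\<lambda>r. exp 1 < max_modulus f r) at_top"
    by (rule transcendental_max_modulus_large[OF assms(1)])
  have "0 \<le> \<rho>"
    unfolding assms(4) by (rule growth_order_nonneg[OF large])
  \<comment> \<open>For \<open>\<rho> = 0\<close> the extended quotient \<open>1 / \<rho>\<close> is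
    \<open>\<infinity>\<close>, and nothing exceeds it.\<close>
  moreover have "\<rho> \<noteq> 0"
    using less by (auto simp: divide_ereal_def)
  ultimately have \<rho>: "0 < \<rho>"
    by simp
  obtain s where s: "1 / \<rho> < ereal s" "ereal s < Liminf sequentially ?L"
    using ereal_dense2[OF less] by blast
  have s0: "0 < s"
    using s(1) \<rho> by (cases \<rho>) (auto intro: less_trans[rotated] simp: one_ereal_def)
  have "eventually (\<lambda>n. ereal s < ?L n) sequentially"
    using less_LiminfD[OF s(2)] .
  then obtain N where N: "\<And>n. n \<ge> N \<Longrightarrow> ereal s < ?L n"
    by (auto simp: eventually_sequentially)
  \<comment> \<open>The univalence estimate controls only the two coefficient moduli together, so
    the recursion runs on their sum.\<close>
  define d where "d n = cmod ((deriv ^^ n) h 0) + cmod ((deriv ^^ n) g 0)" for n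
  have ratio: "real n powr (s - 1) * d (n + 2) \<le> 10 ^ 10 * d (n + 1)" if n: "n \<ge> max N 2" for n
  proof -
    have "ereal (real n powr (s - 1)) < R n"
      using radius_gt_of_log_ratio_gt[OF _ s0 N] n by simp
    then have "inj_on (harmonic_nth_deriv h g n) (ball 0 (real n powr (s - 1)))"
      unfolding assms(5) by (rule inj_on_ball_less_radius_of_univalence)
    then have inj: "inj_on (\<lambda>z. (deriv ^^ n) h z + cnj ((deriv ^^ n) g z)) (ball 0 (real n powr (s - 1)))"
      by (simp add: harmonic_nth_deriv_def[abs_def])
    have "(deriv ^^ n) h holomorphic_on ball 0 (real n powr (s - 1))"
      "(deriv ^^ n) g holomorphic_on ball 0 (real n powr (s - 1))"
      using holomorphic_higher_deriv[OF h open_UNIV] holomorphic_higher_deriv[OF g open_UNIV]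
      by (auto intro: holomorphic_on_subset)
    from injective_harmonic_second_deriv_bound[OF this _ inj] n show ?thesis
      by (simp add: d_def)
  qed
  have "\<exists>K>0. \<exists>B>0. \<forall>n. d n / fact n \<le> K * B ^ n / fact n powr s"
  proof (rule decay_of_ratio_bound[OF _ s0])
    show "real n powr (s - 1) * d (n + 2) \<le> 10 ^ 10 * d (n + 1)" if "n \<ge> max N 2" for n
      using that by (rule ratio)
  qed (simp_all add: d_def)
  then obtain K B where KB: "0 < K" "0 < B" "\<And>n. d n / fact n \<le> K * B ^ n / fact n powr s"
    by blast
  define \<beta> where "\<beta> = s * (2 * B) powr (1 / s)"
  \<comment> \<open>Both \<open>h\<close> and \<open>g\<close> have derivatives at \<open>0\<close>
    dominated by \<open>d\<close>, so one estimate serves for each.\<close>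
  have taylor: "cmod (F z) \<le> 2 * K * exp (\<beta> * cmod z powr (1 / s))"
    if F: "F holomorphic_on UNIV" and Fd: "\<And>n. cmod ((deriv ^^ n) F 0) \<le> d n" for F z
    unfolding \<beta>_def
  proof (rule exponential_growth_of_coefficient_decay[OF _ s0 KB(1,2)])
    show "(\<lambda>n. (deriv ^^ n) F 0 / fact n * z ^ n) sums F z" for z
      using holomorphic_power_series[of F 0 "cmod z + 1" z] F holomorphic_on_subset by force
    show "cmod ((deriv ^^ n) F 0 / fact n) \<le> K * B ^ n / fact n powr s" for n
      using order_trans[OF divide_right_mono[OF Fd[of n], of "fact n"] KB(3)[of n]]
      by (simp add: norm_divide)
  qed
  have "growth_order f \<le> ereal (1 / s)"
  proof (rule growth_order_le[OF cont large])
    show "cmod (f z) \<le> 4 * K * exp (\<beta> * cmod z powr (1 / s))" for z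
    proof -
      have "cmod (f z) \<le> cmod (h z) + cmod (g z)"
        unfolding f using norm_triangle_ineq[of "h z" "cnj (g z)"] by simp
      with taylor[OF h, of z] taylor[OF g, of z] show ?thesis
        by (simp add: d_def)
    qed
  qed (use KB s0 in \<open>auto simp: \<beta>_def\<close>)
  then have "\<rho> \<le> ereal (1 / s)"
    by (simp add: assms(4))
  \<comment> \<open>The choice of \<open>s\<close> gives \<open>1 / s < \<rho>\<close>; the case
    \<open>\<rho> = \<infinity>\<close> is excluded by the finite bound.\<close>
  with \<rho> s(1) s0 show False
    by (cases \<rho>) (auto simp: one_ereal_def field_simps)
qed

end
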